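(* Let $N\ge2$ be an integer and let $p(i),q(i)>0$ with $p(i)+q(i)\le1$ for $i\in\{1,\ldots,N-1\}$ be such that the ratio $r=q(i)/p(i)$ does not depend on $i$. Consider the gambler's ruin game on $\{0,\ldots,N\}$ with winning probabilities $\mathbf{p}=(p(i))$ and losing probabilities $\mathbf{q}=(q(i))$. Then for every $1\le i\le N$, $$EW_{0:i:N}=EW_{0:i:N}(\mathbf{p}\leftrightarrow\mathbf{q}),$$ i.e. the expected duration of the game conditioned on winning is unchanged when the winning and losing probabilities are exchanged.
   Context: Set $p(0)=q(0)=p(N)=q(N)=0$. The gambler's ruin game with rates $\mathbf{p},\mathbf{q}$ is the Markov chain $(X_n)_{n\ge0}$ on $\{0,\ldots,N\}$ that moves from $i$ to $i+1$ with probability $p(i)$, from $i$ to $i-1$ with probability $q(i)$, and stays at $i$ with probability $1-p(i)-q(i)$. For the chain started at $X_0=i$ let $T_{0:i:N}=\inf\{n\ge0:X_n\in\{0,N\}\}$, and let $W_{0:i:N}$ be $T_{0:i:N}$ conditioned on $X_{T_{0:i:N}}=N$ (winning). $EW_{0:i:N}(\mathbf{p}\leftrightarrow\mathbf{q})$ denotes the expectation of the same conditional variable for the game with rates $p'(i)=q(i)$ and $q'(i)=p(i)$ for all $i$. *)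

theory Defs
  imports "HOL-Probability.Probability"
begin

text \<open>
  A (time-homogeneous) Markov chain on the set \<open>S\<close> with transition probabilities \<open>K\<close>, started
  at \<open>i\<close>. The underlying probability space is arbitrary. The transition condition is only imposed
  on histories of positive probability, since \<^const>\<open>cond_prob\<close> is \<open>0\<close> when the
  conditioning event is null.
\<close>
definition markov_chain ::
  "'a measure \<Rightarrow> 's set \<Rightarrow> ('s \<Rightarrow> 's \<Rightarrow> real) \<Rightarrow> 's \<Rightarrow> (nat \<Rightarrow> 'a \<Rightarrow> 's) \<Rightarrow> bool" where
  "markov_chain M S K i X \<longleftrightarrow>
     prob_space M \<and>
     (\<forall>n. X n \<in> measurable M (count_space S)) \<and>
     (AE \<omega> in M. X 0 \<omega> = i) \<and>
     (\<forall>n x. \<forall>j\<in>S. \<P>(\<omega> in M. \<forall>k\<le>n. X k \<omega> = x k) > 0 \<longrightarrow>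
        \<P>(\<omega> in M. X (Suc n) \<omega> = j \<bar> \<forall>k\<le>n. X k \<omega> = x k) = K (x n) j)"

definition gambler_step :: "(nat \<Rightarrow> real) \<Rightarrow> (nat \<Rightarrow> real) \<Rightarrow> nat \<Rightarrow> nat \<Rightarrow> real" where
  "gambler_step p q i j =
     (if j = i + 1 then p i
      else if i = j + 1 then q i
      else if j = i then 1 - p i - q i
      else 0)"

definition gamblers_ruin ::
  "'a measure \<Rightarrow> nat \<Rightarrow> (nat \<Rightarrow> real) \<Rightarrow> (nat \<Rightarrow> real) \<Rightarrow> nat \<Rightarrow> (nat \<Rightarrow> 'a \<Rightarrow> nat) \<Rightarrow> bool" where
  "gamblers_ruin M N p q i X \<longleftrightarrow> markov_chain M {0..N} (gambler_step p q) i X"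

text \<open>The duration is \<open>\<infinity>\<close> if the boundary is never reached (infimum of the empty set).\<close>
definition duration :: "nat \<Rightarrow> (nat \<Rightarrow> 'a \<Rightarrow> nat) \<Rightarrow> 'a \<Rightarrow> enat" where
  "duration N X \<omega> = (INF n\<in>{n. X n \<omega> \<in> {0, N}}. enat n)"

definition win :: "'a measure \<Rightarrow> nat \<Rightarrow> (nat \<Rightarrow> 'a \<Rightarrow> nat) \<Rightarrow> 'a set" where
  "win M N X =
     {\<omega> \<in> space M. duration N X \<omega> \<noteq> \<infinity> \<and> X (the_enat (duration N X \<omega>)) \<omega> = N}"

text \<open>
  The expectation of the duration under the conditional probability given a win, as a value in
  \<open>[0, \<infinity>]\<close>, so that no integrability convention is involved.
\<close>
definition expected_winning_duration :: "'a measure \<Rightarrow> nat \<Rightarrow> (nat \<Rightarrow> 'a \<Rightarrow> nat) \<Rightarrow> ennreal" where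
  "expected_winning_duration M N X =
     (\<integral>\<^sup>+ \<omega>. ennreal_of_enat (duration N X \<omega>) \<partial>(uniform_measure M (win M N X)))"

end

theory Submission
  imports Defs
begin

text \<open>
  Exchanging the winning and losing probabilities multiplies the probability of a step from \<open>k\<close>
  to \<open>j\<close> by \<open>r\<^sup>j / r\<^sup>k\<close>. These factors telescope along a path, so every path from \<open>i\<close> to \<open>N\<close> with
  interior intermediate states has its probability multiplied by the same constant
  \<open>r\<^sup>N / r\<^sup>i\<close>, whatever its length; this constant cancels upon conditioning on a win.
\<close>

section \<open>Probabilities of finite paths\<close>

lemma markov_chain_path_prob_Suc:
  assumes "markov_chain M S K i X" and "x (Suc n) \<in> S"
  shows "\<P>(\<omega> in M. \<forall>k\<le>Suc n. X k \<omega> = x k) =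
    \<P>(\<omega> in M. \<forall>k\<le>n. X k \<omega> = x k) * K (x n) (x (Suc n))"
proof -
  interpret prob_space M using assms(1) by (simp add: markov_chain_def)
  have [measurable]: "X m \<in> measurable M (count_space S)" for m
    using assms(1) by (simp add: markov_chain_def)
  have split: "{\<omega> \<in> space M. \<forall>k\<le>Suc n. X k \<omega> = x k} =
      {\<omega> \<in> space M. X (Suc n) \<omega> = x (Suc n) \<and> (\<forall>k\<le>n. X k \<omega> = x k)}"
    by (auto simp: le_Suc_eq)
  show ?thesis
  proof (cases "\<P>(\<omega> in M. \<forall>k\<le>n. X k \<omega> = x k) > 0")
    case True
    then have "\<P>(\<omega> in M. X (Suc n) \<omega> = x (Suc n) \<bar> \<forall>k\<le>n. X k \<omega> = x k) = K (x n) (x (Suc n))"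
      using assms by (simp add: markov_chain_def)
    with True show ?thesis
      by (simp add: cond_prob_def split field_simps)
  next
    \<comment> \<open>A null history carries no transition condition, but then both sides vanish:
      the longer history is contained in the null one.\<close>
    case False
    then have zero: "\<P>(\<omega> in M. \<forall>k\<le>n. X k \<omega> = x k) = 0"
      using measure_nonneg[of M "{\<omega> \<in> space M. \<forall>k\<le>n. X k \<omega> = x k}"] by linarith
    have "\<P>(\<omega> in M. \<forall>k\<le>Suc n. X k \<omega> = x k) \<le> \<P>(\<omega> in M. \<forall>k\<le>n. X k \<omega> = x k)"
      by (rule finite_measure_mono) (auto, measurable)
    with zero show ?thesis
      using measure_nonneg[of M "{\<omega> \<in> space M. \<forall>k\<le>Suc n. X k \<omega> = x k}"] by simp
  qed
qed

lemma markov_chain_path_prob: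
  assumes "markov_chain M S K i X" and "\<And>k. k \<le> n \<Longrightarrow> x k \<in> S"
  shows "\<P>(\<omega> in M. \<forall>k\<le>n. X k \<omega> = x k) =
    (if x 0 = i then \<Prod>k<n. K (x k) (x (Suc k)) else 0)"
  using assms(2)
proof (induction n)
  case 0
  interpret prob_space M using assms(1) by (simp add: markov_chain_def)
  have [measurable]: "X m \<in> measurable M (count_space S)" for m
    using assms(1) by (simp add: markov_chain_def)
  \<comment> \<open>The start is prescribed only almost surely, so the event
    \<open>X 0 \<omega> = x 0\<close> has probability 1 or 0 according to whether
    \<open>x 0 = i\<close>.\<close>
  have "AE \<omega> in M. X 0 \<omega> = i" using assms(1) by (simp add: markov_chain_def)
  then have "\<P>(\<omega> in M. X 0 \<omega> = x 0) = \<P>(\<omega> in M. i = x 0)"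
    by (intro finite_measure_eq_AE) (auto, measurable)
  then show ?case by (simp add: prob_space)
next
  case (Suc n)
  then show ?case
    using markov_chain_path_prob_Suc[OF assms(1), of x n] by simp
qed

section \<open>Winning at a fixed time\<close>

text \<open>Extensionality makes the set finite and forces distinct paths to differ at some index up
  to \<open>n\<close>, so that their events are disjoint.\<close>

definition winning_paths :: "nat \<Rightarrow> nat \<Rightarrow> (nat \<Rightarrow> nat) set" where
  "winning_paths N n = {x \<in> {..n} \<rightarrow>\<^sub>E {0..N}. (\<forall>k<n. x k \<notin> {0, N}) \<and> x n = N}"

text \<open>Phrasing the event through the coordinates up to \<open>n\<close>, without
  \<open>duration\<close>, lets it be split into finite paths; \<open>win_at_iff\<close> links it to
  the duration.\<close>

definition win_at :: "'a measure \<Rightarrow> nat \<Rightarrow> (nat \<Rightarrow> 'a \<Rightarrow> nat) \<Rightarrow> nat \<Rightarrow> 'a set" where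
  "win_at M N X n = {\<omega> \<in> space M. (\<forall>k<n. X k \<omega> \<notin> {0, N}) \<and> X n \<omega> = N}"

lemma finite_winning_paths: "finite (winning_paths N n)"
  unfolding winning_paths_def by (rule finite_subset[OF _ finite_PiE[of "{..n}" "\<lambda>_. {0..N}"]]) auto

text \<open>The event splits into finitely many disjoint path events, one for each winning path;
  those not starting at \<open>i\<close> contribute 0.\<close>

lemma prob_win_at:
  assumes "gamblers_ruin M N p q i X"
  shows "measure M (win_at M N X n) =
    (\<Sum>x\<in>winning_paths N n. if x 0 = i then \<Prod>k<n. gambler_step p q (x k) (x (Suc k)) else 0)"
proof -
  have mc: "markov_chain M {0..N} (gambler_step p q) i X"
    using assms by (simp add: gamblers_ruin_def)
  interpret prob_space M using mc by (simp add: markov_chain_def)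
  have [measurable]: "X m \<in> measurable M (count_space {0..N})" for m
    using mc by (simp add: markov_chain_def)
  have range: "X m \<omega> \<in> {0..N}" if "\<omega> \<in> space M" for m \<omega>
    using measurable_space[of "X m" M "count_space {0..N}"] that by auto
  let ?path = "\<lambda>x. {\<omega> \<in> space M. \<forall>k\<le>n. X k \<omega> = x k}"
  have "win_at M N X n = (\<Union>x\<in>winning_paths N n. ?path x)"
  proof (intro equalityI subsetI)
    fix \<omega> assume \<omega>: "\<omega> \<in> win_at M N X n"
    then have "(\<lambda>k\<in>{..n}. X k \<omega>) \<in> winning_paths N n"
      using range by (auto simp: win_at_def winning_paths_def)
    moreover have "\<omega> \<in> ?path (\<lambda>k\<in>{..n}. X k \<omega>)"
      using \<omega> by (auto simp: win_at_def)
    ultimately show "\<omega> \<in> (\<Union>x\<in>winning_paths N n. ?path x)" by blast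
  qed (auto simp: win_at_def winning_paths_def)
  moreover have "disjoint_family_on ?path (winning_paths N n)"
    unfolding disjoint_family_on_def
  proof (intro ballI impI)
    fix x y assume xy: "x \<in> winning_paths N n" "y \<in> winning_paths N n" "x \<noteq> y"
    then obtain k where "k \<le> n" "x k \<noteq> y k"
      using PiE_ext[of x "{..n}" "\<lambda>_. {0..N}" y] by (auto simp: winning_paths_def)
    then show "?path x \<inter> ?path y = {}" by force
  qed
  moreover have "?path x \<in> sets M" for x by measurable
  ultimately have "measure M (win_at M N X n) = (\<Sum>x\<in>winning_paths N n. measure M (?path x))"
    by (simp add: finite_measure_finite_Union finite_winning_paths image_subset_iff)
  also have "\<dots> = (\<Sum>x\<in>winning_paths N n.
      if x 0 = i then \<Prod>k<n. gambler_step p q (x k) (x (Suc k)) else 0)"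
    by (intro sum.cong refl markov_chain_path_prob[OF mc]) (auto simp: winning_paths_def)
  finally show ?thesis .
qed

section \<open>Decomposing the win by its duration\<close>

lemma duration_eq_enat_iff:
  "duration N X \<omega> = enat n \<longleftrightarrow> X n \<omega> \<in> {0, N} \<and> (\<forall>k<n. X k \<omega> \<notin> {0, N})"
proof
  assume "duration N X \<omega> = enat n"
  then have inf: "(INF m\<in>{m. X m \<omega> \<in> {0, N}}. enat m) = enat n" by (simp add: duration_def)
  \<comment> \<open>An empty index set would give \<open>\<infinity>\<close>, so the finite value
    means that the boundary is reached. A nonempty infimum in \<open>enat\<close> is attained, which
    makes \<open>n\<close> itself a hitting time.\<close>
  then have ne: "enat ` {m. X m \<omega> \<in> {0, N}} \<noteq> {}"
    by (metis Inf_empty enat.distinct(1) top_enat_def)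
  have "Inf (enat ` {m. X m \<omega> \<in> {0, N}}) \<in> enat ` {m. X m \<omega> \<in> {0, N}}"
    using ne unfolding Inf_enat_def by (metis LeastI ex_in_conv)
  then have "X n \<omega> \<in> {0, N}" using inf by auto
  moreover have "X k \<omega> \<notin> {0, N}" if "k < n" for k
  proof
    assume "X k \<omega> \<in> {0, N}"
    then have "(INF m\<in>{m. X m \<omega> \<in> {0, N}}. enat m) \<le> enat k" by (intro INF_lower) auto
    with inf that show False by simp
  qed
  ultimately show "X n \<omega> \<in> {0, N} \<and> (\<forall>k<n. X k \<omega> \<notin> {0, N})" by blast
next
  assume "X n \<omega> \<in> {0, N} \<and> (\<forall>k<n. X k \<omega> \<notin> {0, N})"
  then show "duration N X \<omega> = enat n"
    unfolding duration_def
    by (intro antisym INF_lower INF_greatest) (auto simp: not_less[symmetric])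
qed

lemma win_at_iff:
  assumes "\<omega> \<in> space M"
  shows "\<omega> \<in> win_at M N X n \<longleftrightarrow> \<omega> \<in> win M N X \<and> duration N X \<omega> = enat n"
proof (cases "duration N X \<omega> = enat n")
  case True
  then show ?thesis
    using assms duration_eq_enat_iff[of N X \<omega> n] by (auto simp: win_at_def win_def)
next
  case False
  then show ?thesis
    using duration_eq_enat_iff[of N X \<omega> n] by (auto simp: win_at_def)
qed

lemma win_eq_Union_win_at: "win M N X = (\<Union>n. win_at M N X n)"
proof (intro equalityI subsetI)
  fix \<omega> assume \<omega>: "\<omega> \<in> win M N X"
  then obtain n where "duration N X \<omega> = enat n" by (auto simp: win_def)
  with \<omega> show "\<omega> \<in> (\<Union>n. win_at M N X n)"
    using win_at_iff[of \<omega> M N X n] by (auto simp: win_def)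
next
  fix \<omega> assume "\<omega> \<in> (\<Union>n. win_at M N X n)"
  then show "\<omega> \<in> win M N X"
    using win_at_iff[of \<omega> M N X] by (auto simp: win_at_def)
qed

lemma disjoint_win_at: "disjoint_family (win_at M N X)"
  unfolding disjoint_family_on_def
proof (intro ballI impI)
  fix m n :: nat assume "m \<noteq> n"
  have "m = n" if "\<omega> \<in> win_at M N X m" "\<omega> \<in> win_at M N X n" for \<omega>
    using that win_at_iff[of \<omega> M N X m] win_at_iff[of \<omega> M N X n] by (auto simp: win_at_def)
  with \<open>m \<noteq> n\<close> show "win_at M N X m \<inter> win_at M N X n = {}" by blast
qed

text \<open>On \<open>win\<close> the duration is \<open>n\<close> exactly on
  \<open>win_at M N X n\<close>, so the integral splits termwise over these disjoint events, and
  conditioning divides by their total measure. Two games can then be compared for each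
  \<open>n\<close> separately.\<close>

lemma expected_winning_duration_eq:
  assumes "\<And>n. X n \<in> measurable M (count_space {0..N})"
  shows "expected_winning_duration M N X =
    (\<Sum>n. of_nat n * emeasure M (win_at M N X n)) / (\<Sum>n. emeasure M (win_at M N X n))"
proof -
  note [measurable] = assms
  have win_at[measurable]: "win_at M N X n \<in> sets M" for n
    unfolding win_at_def insert_iff empty_iff de_Morgan_disj simp_thms by measurable
  then have win[measurable]: "win M N X \<in> sets M"
    unfolding win_eq_Union_win_at by auto
  \<comment> \<open>For measurability, the infimum over an index set varying with
    \<open>\<omega>\<close> becomes a fixed countable infimum of functions of a single coordinate,
    with \<open>\<infinity>\<close> as the neutral value.\<close>
  have "duration N X = (\<lambda>\<omega>. INF n. if X n \<omega> \<in> {0, N} then enat n else \<infinity>)"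
  proof (intro ext antisym)
    fix \<omega>
    show "duration N X \<omega> \<le> (INF n. if X n \<omega> \<in> {0, N} then enat n else \<infinity>)"
      by (rule INF_greatest) (simp add: duration_def INF_lower)
    show "(INF n. if X n \<omega> \<in> {0, N} then enat n else \<infinity>) \<le> duration N X \<omega>"
      unfolding duration_def
    proof (rule INF_greatest)
      fix n assume "n \<in> {n. X n \<omega> \<in> {0, N}}"
      then show "(INF n. if X n \<omega> \<in> {0, N} then enat n else \<infinity>) \<le> enat n"
        by (intro INF_lower2[of n]) auto
    qed
  qed
  moreover have "(\<lambda>\<omega>. if X n \<omega> \<in> {0, N} then enat n else \<infinity>) \<in> measurable M (count_space UNIV)" for n
    by (rule measurable_compose[OF assms]) simp
  ultimately have [measurable]: "duration N X \<in> measurable M (count_space UNIV)"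
    by (simp only:) (rule measurable_INF, auto)
  have summand: "ennreal_of_enat (duration N X \<omega>) * indicator (win M N X) \<omega> =
      (\<Sum>n. of_nat n * indicator (win_at M N X n) \<omega>)" if \<omega>: "\<omega> \<in> space M" for \<omega>
  proof (cases "\<omega> \<in> win M N X")
    case True
    then obtain m where m: "duration N X \<omega> = enat m" by (auto simp: win_def)
    have "(\<Sum>n. of_nat n * indicator (win_at M N X n) \<omega> :: ennreal) =
        (\<Sum>n\<in>{m}. of_nat n * indicator (win_at M N X n) \<omega>)"
      using True m win_at_iff[OF \<omega>, of N X] by (intro suminf_finite) auto
    then show ?thesis using True m win_at_iff[OF \<omega>, of N X] by simp
  next
    case False
    \<comment> \<open>Both sides are 0 here even if the duration is infinite, since
      \<open>\<infinity> * 0 = 0\<close> in \<open>ennreal\<close>.\<close>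
    then show ?thesis using win_at_iff[OF \<omega>, of N X] by simp
  qed
  have "expected_winning_duration M N X =
      (\<integral>\<^sup>+\<omega>. ennreal_of_enat (duration N X \<omega>) * indicator (win M N X) \<omega> \<partial>M) / emeasure M (win M N X)"
    unfolding expected_winning_duration_def by (rule nn_integral_uniform_measure) measurable
  also have "(\<integral>\<^sup>+\<omega>. ennreal_of_enat (duration N X \<omega>) * indicator (win M N X) \<omega> \<partial>M) =
      (\<integral>\<^sup>+\<omega>. (\<Sum>n. of_nat n * indicator (win_at M N X n) \<omega>) \<partial>M)"
    by (intro nn_integral_cong summand)
  also have "\<dots> = (\<Sum>n. of_nat n * emeasure M (win_at M N X n))"
    by (simp add: nn_integral_suminf nn_integral_cmult)
  also have "emeasure M (win M N X) = (\<Sum>n. emeasure M (win_at M N X n))"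
    unfolding win_eq_Union_win_at
    by (intro suminf_emeasure[symmetric] disjoint_win_at) (auto intro: win_at)
  finally show ?thesis .
qed

section \<open>Exchanging the probabilities\<close>

text \<open>Going up now has probability \<open>q k = r * p k\<close>, going down
  \<open>p k = q k / r\<close>, and the probability of staying is symmetric in \<open>p\<close> and
  \<open>q\<close>: the factor is \<open>r\<close> to the power of the displacement.\<close>

lemma gambler_step_swap:
  assumes "p k > 0" and "q k / p k = r" and "r > 0"
  shows "gambler_step q p k j = r ^ j / r ^ k * gambler_step p q k j"
proof -
  have "q k = r * p k" using assms by (auto simp: field_simps)
  then show ?thesis using assms by (auto simp: gambler_step_def field_simps)
qed

theorem theorem2p8:
  fixes N i :: nat and p q :: "nat \<Rightarrow> real" and r :: real
    and M :: "'a measure" and X :: "nat \<Rightarrow> 'a \<Rightarrow> nat"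
    and M' :: "'b measure" and Y :: "nat \<Rightarrow> 'b \<Rightarrow> nat"
  assumes "N \<ge> 2"
    and "p 0 = 0" and "q 0 = 0" and "p N = 0" and "q N = 0"
    and "\<And>k. k \<in> {1..N - 1} \<Longrightarrow> p k > 0"
    and "\<And>k. k \<in> {1..N - 1} \<Longrightarrow> q k > 0"
    and "\<And>k. k \<in> {1..N - 1} \<Longrightarrow> p k + q k \<le> 1"
    and "\<And>k. k \<in> {1..N - 1} \<Longrightarrow> q k / p k = r"
    and "1 \<le> i" and "i \<le> N"
    and "gamblers_ruin M N p q i X"
    and "gamblers_ruin M' N q p i Y"
  shows "expected_winning_duration M N X = expected_winning_duration M' N Y"
proof -
  \<comment> \<open>As \<open>N \<ge> 2\<close>, state 1 is interior and witnesses the positivity of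
    \<open>r\<close>.\<close>
  have "p 1 > 0" "q 1 > 0" "q 1 / p 1 = r" using assms(1,6,7,9) by auto
  then have "r > 0" by auto
  \<comment> \<open>The factor \<open>r ^ x n / r ^ x 0\<close> of a path with
    \<open>x 0 = i\<close> and \<open>x n = N\<close>, the same for all lengths
    \<open>n\<close>.\<close>
  define c where "c = r ^ N / r ^ i"
  have "c > 0" using \<open>r > 0\<close> by (simp add: c_def)
  interpret M: prob_space M using assms(12) by (simp add: gamblers_ruin_def markov_chain_def)
  interpret M': prob_space M' using assms(13) by (simp add: gamblers_ruin_def markov_chain_def)
  \<comment> \<open>The powers of \<open>r\<close> telescope. Only the states that are left must be
    interior, where the ratio is known; the last state \<open>x n\<close> may lie on the
    boundary.\<close>
  have path: "(\<Prod>k<n. gambler_step q p (x k) (x (Suc k))) =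
      r ^ x n / r ^ x 0 * (\<Prod>k<n. gambler_step p q (x k) (x (Suc k)))"
    if "\<And>k. k < n \<Longrightarrow> x k \<in> {1..N - 1}" for n x
    using that
  proof (induction n)
    case 0
    then show ?case using \<open>r > 0\<close> by simp
  next
    case (Suc n)
    then have "gambler_step q p (x n) (x (Suc n)) =
        r ^ x (Suc n) / r ^ x n * gambler_step p q (x n) (x (Suc n))"
      using assms(6,9) \<open>r > 0\<close> by (intro gambler_step_swap) auto
    with Suc \<open>r > 0\<close> show ?case by simp
  qed
  have "measure M' (win_at M' N Y n) = c * measure M (win_at M N X n)" for n
    unfolding prob_win_at[OF assms(12)] prob_win_at[OF assms(13)] sum_distrib_left
  proof (rule sum.cong)
    fix x assume x: "x \<in> winning_paths N n"
    have "x k \<in> {1..N - 1}" if "k < n" for k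
    proof -
      have "x k \<le> N" "x k \<noteq> 0" "x k \<noteq> N"
        using x that by (auto simp: winning_paths_def PiE_iff)
      then show ?thesis by simp
    qed
    with path[of n x] x
    show "(if x 0 = i then \<Prod>k<n. gambler_step q p (x k) (x (Suc k)) else 0) =
        c * (if x 0 = i then \<Prod>k<n. gambler_step p q (x k) (x (Suc k)) else 0)"
      by (auto simp: c_def winning_paths_def)
  qed simp
  then have scale: "emeasure M' (win_at M' N Y n) = ennreal c * emeasure M (win_at M N X n)" for n
    using \<open>c > 0\<close> by (simp add: M.emeasure_eq_measure M'.emeasure_eq_measure ennreal_mult)
  have "expected_winning_duration M' N Y =
      (\<Sum>n. of_nat n * emeasure M' (win_at M' N Y n)) / (\<Sum>n. emeasure M' (win_at M' N Y n))"
    using assms(13) by (intro expected_winning_duration_eq) (simp add: gamblers_ruin_def markov_chain_def)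
  also have "\<dots> = (ennreal c * (\<Sum>n. of_nat n * emeasure M (win_at M N X n))) /
      (ennreal c * (\<Sum>n. emeasure M (win_at M N X n)))"
    by (simp add: scale mult.left_commute)
  \<comment> \<open>Cancelling is valid in \<open>ennreal\<close> because \<open>ennreal c\<close>
    is neither 0 nor \<open>\<infinity>\<close>, whatever the values of the two series.\<close>
  also have "\<dots> = (\<Sum>n. of_nat n * emeasure M (win_at M N X n)) / (\<Sum>n. emeasure M (win_at M N X n))"
    using \<open>c > 0\<close> by (simp add: mult.commute[of "ennreal c"] divide_mult_eq)
  also have "\<dots> = expected_winning_duration M N X"
    using assms(12)
    by (intro expected_winning_duration_eq[symmetric]) (simp add: gamblers_ruin_def markov_chain_def)
  finally show ?thesis by simp
qed

end
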